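(* For every integer $n\ge0$ let $$P_n=P_n(q)=\sum_{j\ge0}\sum_{k\ge0}(-1)^kq^{j^2+2j+2k}\begin{bmatrix} j+k-1\\ k\end{bmatrix}_{q^2}\begin{bmatrix} n-k\\ j\end{bmatrix}_{q^2}.$$ Then $$P_n=\sum_{k=-\infty}^\infty\Big[q^{10k^2+3k}\,U(n+1,5k;q)-q^{10k^2+7k+1}\,U(n+1,5k+1;q)\Big],$$ and $P_0=1$, $P_1=q^3+1$, and $P_n=(1-q^2+q^{2n+1})P_{n-1}+q^2P_{n-2}$ for $n\ge2$.
   Context: $q$ is an indeterminate. $(a;p)_n=\prod_{i=0}^{n-1}(1-ap^i)$. The Gaussian polynomial in base $p$ is $\begin{bmatrix} A\\ B\end{bmatrix}_{p}=\frac{(p;p)_A}{(p;p)_B(p;p)_{A-B}}$ if $0\le B\le A$, and $0$ otherwise; the only exception is that the factor $\begin{bmatrix} j+k-1\\ k\end{bmatrix}_{q^2}$ is taken to be $1$ when $j=k=0$. For integers $L\ge0$ and $A$, $$T_0(L,A;q)=\sum_{r=0}^L(-1)^r\begin{bmatrix} L\\ r\end{bmatrix}_{q^2}\begin{bmatrix} 2L-2r\\ L-A-r\end{bmatrix}_{q},\qquad U(L,A;q)=T_0(L,A;q)+T_0(L,A+1;q).$$ All sums have only finitely many nonzero terms. *)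

theory Defs
  imports
    "HOL-Computational_Algebra.Computational_Algebra"
    "HOL-Library.Groups_Big_Fun"
begin

definition qpoch :: "'a::comm_ring_1 \<Rightarrow> 'a \<Rightarrow> nat \<Rightarrow> 'a" where
  "qpoch a p n = (\<Prod>i<n. 1 - a * p ^ i)"

(* The defining quotient is taken in a field; it is meaningful when p is not a root of unity,
   in particular when p is a power of the indeterminate below. *)
definition gauss :: "'a::field \<Rightarrow> int \<Rightarrow> int \<Rightarrow> 'a" where
  "gauss p A B =
     (if 0 \<le> B \<and> B \<le> A
      then qpoch p p (nat A) / (qpoch p p (nat B) * qpoch p p (nat (A - B)))
      else 0)"

(* The factor [j + k - 1, k] in base p, with the convention that it is 1 at j = k = 0,
   where gauss p (-1) 0 would be 0. *)
definition gauss_shifted :: "'a::field \<Rightarrow> nat \<Rightarrow> nat \<Rightarrow> 'a" where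
  "gauss_shifted p j k =
     (if j = 0 \<and> k = 0 then 1 else gauss p (int j + int k - 1) (int k))"

definition T0 :: "nat \<Rightarrow> int \<Rightarrow> 'a::field \<Rightarrow> 'a" where
  "T0 L A q =
     (\<Sum>r=0..L. (-1) ^ r * gauss (q\<^sup>2) (int L) (int r)
                 * gauss q (2 * int L - 2 * int r) (int L - A - int r))"

definition U :: "nat \<Rightarrow> int \<Rightarrow> 'a::field \<Rightarrow> 'a" where
  "U L A q = T0 L A q + T0 L (A + 1) q"

(* Sum_any is the sum over the support, and is 0 if the support is infinite. That the supports
   of all the sums involved are finite is proved below. *)
definition P_summand :: "nat \<Rightarrow> 'a::field \<Rightarrow> nat \<Rightarrow> nat \<Rightarrow> 'a" where
  "P_summand n q j k =
     (-1) ^ k * q ^ (j\<^sup>2 + 2 * j + 2 * k)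
       * gauss_shifted (q\<^sup>2) j k * gauss (q\<^sup>2) (int n - int k) (int j)"

definition P :: "nat \<Rightarrow> 'a::field \<Rightarrow> 'a" where
  "P n q = Sum_any (\<lambda>j. Sum_any (\<lambda>k. P_summand n q j k))"

(* The indeterminate q, in the field of fractions of \<int>[q], that is, in the field of
   rational functions over the rationals. *)
definition qvar :: "int poly fract" where
  "qvar = to_fract [:0, 1:]"

lemma P_summand_eq_0: "P_summand n q j k = 0" if "j > n \<or> k > n"
  using that by (auto simp: P_summand_def gauss_def)

lemma finite_P_summand_inner: "finite {k. P_summand n q j k \<noteq> 0}"
proof (rule finite_subset)
  show "{k. P_summand n q j k \<noteq> 0} \<subseteq> {..n}"
    using P_summand_eq_0[of n j] by (force simp: not_le[symmetric])
qed simp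

lemma finite_P_summand_outer:
  "finite {j. Sum_any (\<lambda>k. P_summand n q j k) \<noteq> 0}"
proof (rule finite_subset)
  have "Sum_any (\<lambda>k. P_summand n q j k) = 0" if "j > n" for j
    using that by (simp add: P_summand_eq_0)
  then show "{j. Sum_any (\<lambda>k. P_summand n q j k) \<noteq> 0} \<subseteq> {..n}"
    by (metis (mono_tags, lifting) atMost_iff mem_Collect_eq not_le subsetI)
qed simp

lemma T0_eq_0: "T0 L A q = 0" if "\<bar>A\<bar> > int L"
  unfolding T0_def by (rule sum.neutral) (use that in \<open>auto simp: gauss_def\<close>)

lemma finite_U_summand:
  "finite {k::int. q powi (10 * k\<^sup>2 + 3 * k) * U (n + 1) (5 * k) q
             - q powi (10 * k\<^sup>2 + 7 * k + 1) * U (n + 1) (5 * k + 1) q \<noteq> 0}"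
  (is "finite {k. ?f k \<noteq> 0}")
proof (rule finite_subset)
  have *: "?f k = 0" if "\<not> (- int n - 2 \<le> k \<and> k \<le> int n + 2)" for k
  proof -
    have "T0 (n + 1) (5 * k) q = 0" "T0 (n + 1) (5 * k + 1) q = 0" "T0 (n + 1) (5 * k + 1 + 1) q = 0"
      using that by (intro T0_eq_0, linarith)+
    then have "U (n + 1) (5 * k) q = 0" "U (n + 1) (5 * k + 1) q = 0"
      unfolding U_def by (simp_all only: add_0_left)
    then show ?thesis by simp
  qed
  show "{k. ?f k \<noteq> 0} \<subseteq> {- int n - 2..int n + 2}"
  proof
    fix k assume "k \<in> {k. ?f k \<noteq> 0}"
    then have "?f k \<noteq> 0" by simp
    then show "k \<in> {- int n - 2..int n + 2}"
      using *[of k] by (auto simp only: atLeastAtMost_iff)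
  qed
qed simp

end

theory Submission
  imports Defs
begin

unbundle fps_syntax

text \<open>
  Both sides are shown to satisfy the three-term recurrence of the conclusion with the same
  two initial values; everything happens over an arbitrary field in which \<open>q\<close> is nonzero and
  not a root of unity.

  \<^emph>\<open>The fermionic side.\<close>  For fixed \<open>j\<close> the sum over \<open>k\<close> is a Cauchy product; with \<open>p = q\<^sup>2\<close> its
  generating function in \<open>x\<close> is \<open>x^j / ((x;p)_(j+1) (-p x;p)_j)\<close>.  Multiplying it by
  \<open>(1 - x) (1 + p x)\<close> gives, up to a power of \<open>p\<close>, \<open>x\<close> times the function of index \<open>j - 1\<close> at
  \<open>p x\<close> (\<open>inner_sum_Suc_rec\<close>).  The weights \<open>q^(j^2+2j)\<close> turn the powers of \<open>p\<close> into the single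
  factor \<open>q^(2n+1)\<close>, so summation over \<open>j\<close> closes up on \<open>P\<close> itself (\<open>P_rec\<close>).

  \<^emph>\<open>The theta side.\<close>  Together with its companion \<open>T1\<close>, the q-trinomial coefficient \<open>T0\<close> is even
  in \<open>A\<close> and satisfies two relations: \<open>T1_diff\<close> trades a difference of \<open>T1\<close> for \<open>T0\<close>, and \<open>T0_Suc\<close>
  lowers the first argument.  Because of the quadratic exponent \<open>10 k^2 + a k + b\<close>, factors
  \<open>q^(u + v A)\<close> with \<open>A = 5 k + c\<close> only move the parameters \<open>a\<close> and \<open>b\<close> of a theta sum, and the
  substitutions \<open>k \<mapsto> -k\<close> and \<open>k \<mapsto> k + 1\<close> identify different parameters.  Split the right-hand
  side into the parts coming from the two terms of \<open>U\<close>: the part \<open>L(m)\<close> that uses \<open>T0(m, A)\<close>, and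
  the part \<open>M(m)\<close> that uses \<open>T0(m, A + 1)\<close>.  After applying the relations, almost everything
  cancels in pairs and leaves
    \<open>L(m+1) = M(m)\<close>  and  \<open>M(m+1) = L(m) + q^(2m+1) M(m)\<close>
  (\<open>theta_left_Suc\<close>, \<open>theta_right_Suc\<close>), from which the recurrence for \<open>L(n+1) + M(n+1)\<close> is
  immediate.
\<close>

section \<open>Gaussian polynomials in a generic base\<close>

locale generic_base =
  fixes q :: "'a::field"
  assumes nonzero: "q \<noteq> 0"
    and power_neq_1: "n > 0 \<Longrightarrow> q ^ n \<noteq> 1"

lemma (in generic_base) generic_base_square: "generic_base (q\<^sup>2)"
  by standard (use nonzero power_neq_1 in \<open>auto simp flip: power_mult\<close>)

lemma generic_base_qvar: "generic_base qvar"
proof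
  show "qvar \<noteq> 0"
    by (simp add: qvar_def)
  fix n :: nat
  assume "n > 0"
  have "to_fract ([:0, 1:] ^ n) = qvar ^ n"
    by (induction n) (simp_all add: qvar_def del: mult_pCons_left)
  moreover have "[:0, 1::int:] ^ n \<noteq> 1"
    using \<open>n > 0\<close> degree_linear_power[of "0::int" n] by (metis degree_1 less_irrefl)
  ultimately show "qvar ^ n \<noteq> 1"
    by (metis to_fract_1 to_fract_eq_iff)
qed

context generic_base
begin

lemma power_int_neq_1: "n \<noteq> 0 \<Longrightarrow> q powi n \<noteq> 1"
  using power_neq_1[of "nat \<bar>n\<bar>"] nonzero
  by (auto simp: power_int_def power_inverse inverse_eq_1_iff split: if_splits)

lemma qpoch_Suc: "qpoch q q (Suc n) = qpoch q q n * (1 - q ^ Suc n)"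
  by (simp add: qpoch_def)

lemma qpoch_nonzero: "qpoch q q n \<noteq> 0"
  using power_neq_1[of "Suc _"] by (auto simp: qpoch_def)

text \<open>
  Valid for all integers: outside \<open>1 \<le> B \<le> N\<close> the right-hand polynomial is zero, and on the
  left either the polynomial or, at \<open>B = 0\<close>, the factor vanishes.  The remaining identities of this
  section follow from this one and \<open>gauss_sym\<close> by algebra, without further case distinctions.
\<close>
lemma gauss_absorb_bottom:
  "(1 - q powi B) * gauss q N B = (1 - q powi N) * gauss q (N - 1) (B - 1)"
proof (cases "1 \<le> B \<and> B \<le> N")
  case True
  define b where "b = nat (B - 1)"
  define c where "c = nat (N - B)"
  have B: "B = int (Suc b)" and N: "N = int (Suc (b + c))"
    using True by (auto simp: b_def c_def)
  have nat_simps: "nat B = Suc b" "nat N = Suc (b + c)" "nat (N - B) = c"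
    "nat (N - 1) = b + c" "nat (B - 1) = b" "N - 1 - (B - 1) = N - B"
    by (auto simp: B N)
  have powi: "q powi B = q ^ Suc b" "q powi N = q ^ Suc (b + c)"
    unfolding B N by (rule power_int_of_nat)+
  have "1 - q ^ Suc b \<noteq> 0"
    using power_neq_1[of "Suc b"] by simp
  then show ?thesis
    using True qpoch_nonzero
    unfolding gauss_def powi nat_simps qpoch_Suc by (auto simp: divide_simps simp del: power_Suc)
next
  case False
  then show ?thesis
    by (auto simp: gauss_def)
qed

lemma gauss_sym: "gauss q N (N - B) = gauss q N B"
  by (auto simp: gauss_def mult.commute)

lemma gauss_absorb_top:
  "(1 - q powi (N - B)) * gauss q N B = (1 - q powi N) * gauss q (N - 1) B"
  using gauss_absorb_bottom[of "N - B" N] gauss_sym[of N B] gauss_sym[of "N - 1" B]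
  by (simp add: algebra_simps)

lemma gauss_absorb_shift:
  "(1 - q powi B) * gauss q N B = (1 - q powi (N - B + 1)) * gauss q N (B - 1)"
proof -
  have "N - (B - 1) = N - B + 1"
    by simp
  then show ?thesis
    using gauss_absorb_bottom[of B N] gauss_absorb_top[of N "B - 1"] by metis
qed

text \<open>
  The absorption factors of the two summands combine to \<open>1 - q powi N\<close>, which can be cancelled
  precisely when \<open>N\<close> is nonzero; at \<open>N = B = 0\<close> the identity fails.
\<close>
lemma gauss_Pascal_bottom:
  assumes "N \<noteq> 0"
  shows "gauss q N B = gauss q (N - 1) (B - 1) + q powi B * gauss q (N - 1) B"
proof -
  have split: "q powi N = q powi B * q powi (N - B)"
    using nonzero by (simp flip: power_int_add)
  have "(1 - q powi N) * gauss q N B =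
      (1 - q powi B) * gauss q N B + q powi B * ((1 - q powi (N - B)) * gauss q N B)"
    by (simp add: split algebra_simps)
  also have "\<dots> = (1 - q powi N) * (gauss q (N - 1) (B - 1) + q powi B * gauss q (N - 1) B)"
    unfolding gauss_absorb_bottom gauss_absorb_top by (simp add: algebra_simps)
  finally show ?thesis
    using power_int_neq_1[OF assms] by simp
qed

lemma gauss_Pascal_top:
  assumes "N \<noteq> 0"
  shows "gauss q N B = gauss q (N - 1) B + q powi (N - B) * gauss q (N - 1) (B - 1)"
  using gauss_Pascal_bottom[OF assms, of "N - B"] gauss_sym[of N B] gauss_sym[of "N - 1" B]
    gauss_sym[of "N - 1" "B - 1"]
  by (simp add: algebra_simps)

end

section \<open>The q-trinomial coefficients\<close>

text \<open>The companion of \<open>T0\<close> introduced by Andrews and Baxter, with sign \<open>-q\<close> instead of \<open>-1\<close>.\<close>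
definition T1 :: "nat \<Rightarrow> int \<Rightarrow> 'a::field \<Rightarrow> 'a" where
  "T1 L A q =
     (\<Sum>r=0..L. (-q) ^ r * gauss (q\<^sup>2) (int L) (int r)
                 * gauss q (2 * int L - 2 * int r) (int L - A - int r))"

lemma T1_eq_0: "T1 L A q = 0" if "\<bar>A\<bar> > int L"
  unfolding T1_def by (rule sum.neutral) (use that in \<open>auto simp: gauss_def\<close>)

context generic_base
begin

lemma gauss_central_sym:
  "gauss q (2 * L - 2 * r) (L - (- A) - r) = gauss q (2 * L - 2 * r) (L - A - r)"
  using gauss_sym[of "2 * L - 2 * r" "L - A - r"] by (simp add: algebra_simps)

lemma T0_sym: "T0 L (- A) q = T0 L A q"
  by (simp only: T0_def gauss_central_sym)

lemma T1_sym: "T1 L (- A) q = T1 L A q"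
  by (simp only: T1_def gauss_central_sym)

text \<open>
  The identity already holds summand by summand: after division by \<open>q^r\<close> each summand is an
  instance of \<open>gauss_absorb_shift\<close>.
\<close>
lemma T1_diff:
  "T1 m (A + 1) q - T1 m A q =
     q powi (int m + A + 1) * T0 m (A + 1) q - q powi (int m - A) * T0 m A q"
proof -
  have step: "(-q) ^ r * a * gauss q (2 * int m - 2 * int r) (int m - (A + 1) - int r)
        - (-q) ^ r * a * gauss q (2 * int m - 2 * int r) (int m - A - int r)
      = q powi (int m + A + 1) *
            ((-1) ^ r * a * gauss q (2 * int m - 2 * int r) (int m - (A + 1) - int r))
        - q powi (int m - A) *
            ((-1) ^ r * a * gauss q (2 * int m - 2 * int r) (int m - A - int r))" for r a
  proof -
    define s where "s = int m - int r"
    have e: "2 * int m - 2 * int r = 2 * s" "int m - (A + 1) - int r = s - A - 1"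
       "int m - A - int r = s - A"
       "q powi (int m + A + 1) = q ^ r * q powi (s + A + 1)"
       "q powi (int m - A) = q ^ r * q powi (s - A)"
      using nonzero
      by (auto simp: s_def add.assoc simp flip: power_int_add power_int_of_nat)
    have minus_power: "(-q) ^ r = (-1) ^ r * q ^ r"
      by (rule power_minus)
    have "(1 - q powi (s - A)) * gauss q (2 * s) (s - A) =
        (1 - q powi (s + A + 1)) * gauss q (2 * s) (s - A - 1)"
      using gauss_absorb_shift[of "s - A" "2 * s"] by (simp add: algebra_simps)
    moreover have "u * z * a * h - u * z * a * g = z * Y * (u * a * h) - z * X * (u * a * g)"
      if "(1 - X) * g = (1 - Y) * h" for u z X Y g h :: 'a
      using that by algebra
    ultimately show ?thesis
      unfolding e minus_power by blast
  qed
  show ?thesis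
    unfolding T0_def T1_def sum_distrib_left sum_subtractf[symmetric]
    by (intro sum.cong refl step)
qed

text \<open>Summation by parts for Pascal's rule: the terms with \<open>[m, r - 1]\<close> are shifted by one.\<close>
lemma alternating_Pascal:
  "(\<Sum>r=0..Suc m. (-1) ^ r * gauss q (int (Suc m)) (int r) * f r) =
   (\<Sum>r=0..m. (-1) ^ r * gauss q (int m) (int r) * (q ^ r * f r - f (Suc r)))"
proof -
  define g where "g r = (-1) ^ r * gauss q (int m) (int r - 1) * f r" for r
  have "(-1) ^ r * gauss q (int (Suc m)) (int r) * f r =
      (-1) ^ r * gauss q (int m) (int r) * (q ^ r * f r - f (Suc r)) + (g r - g (Suc r))" for r
    using gauss_Pascal_bottom[of "int (Suc m)" "int r"] by (simp add: g_def algebra_simps)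
  then have "(\<Sum>r=0..Suc m. (-1) ^ r * gauss q (int (Suc m)) (int r) * f r) =
      (\<Sum>r=0..Suc m. (-1) ^ r * gauss q (int m) (int r) * (q ^ r * f r - f (Suc r)))
      + (\<Sum>r\<le>Suc m. g r - g (Suc r))"
    by (simp only: sum.distrib atLeast0AtMost)
  moreover have "(\<Sum>r\<le>Suc m. g r - g (Suc r)) = 0"
    by (subst sum_telescope) (simp add: g_def gauss_def)
  moreover have "gauss q (int m) (int (Suc m)) = 0"
    by (simp add: gauss_def)
  ultimately show ?thesis
    by simp
qed

text \<open>
  Absorption turns both factors into \<open>1 - q ^ m\<close> and the two Gaussian polynomials into
  \<open>[m - 1, r - 1]\<close> and \<open>[m - 1, r]\<close>, so that the alternating sum telescopes.
\<close>
lemma alternating_sum_eq_0: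
  "(\<Sum>r=0..m. (-1) ^ r * gauss q (int m) (int r) *
      ((1 - q ^ r) * h r + (1 - q ^ (m - r)) * h (Suc r))) = 0"
proof -
  define g where "g r = (-1) ^ r * gauss q (int m - 1) (int r - 1) * h r" for r
  have "(-1) ^ r * gauss q (int m) (int r) * ((1 - q ^ r) * h r + (1 - q ^ (m - r)) * h (Suc r))
      = (1 - q ^ m) * (g r - g (Suc r))" if "r \<le> m" for r
  proof -
    have "(1 - q ^ r) * gauss q (int m) (int r) =
        (1 - q ^ m) * gauss q (int m - 1) (int r - 1)"
      using gauss_absorb_bottom[of "int r" "int m"] by simp
    moreover have "(1 - q ^ (m - r)) * gauss q (int m) (int r) =
        (1 - q ^ m) * gauss q (int m - 1) (int r)"
      using gauss_absorb_top[of "int m" "int r"] that by (simp flip: of_nat_diff)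
    moreover have "g (Suc r) = - ((-1) ^ r * gauss q (int m - 1) (int r) * h (Suc r))"
      by (simp add: g_def)
    moreover have "u * x * (X * a + Y * b) = M * (u * y * a - (- (u * z * b)))"
      if "X * x = M * y" "Y * x = M * z" for u x y z M X Y a b :: 'a
      using that by algebra
    ultimately show ?thesis
      unfolding g_def[of r] by presburger
  qed
  then have "(\<Sum>r=0..m. (-1) ^ r * gauss q (int m) (int r) *
      ((1 - q ^ r) * h r + (1 - q ^ (m - r)) * h (Suc r)))
      = (1 - q ^ m) * (\<Sum>r\<le>m. g r - g (Suc r))"
    by (simp add: sum_distrib_left atLeast0AtMost)
  also have "(\<Sum>r\<le>m. g r - g (Suc r)) = 0"
    by (subst sum_telescope) (simp add: g_def gauss_def)
  finally show ?thesis
    by simp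
qed

text \<open>
  The relation is not true summand by summand.  Expanding the base \<open>q\<^sup>2\<close> factor by
  \<open>alternating_Pascal\<close> and the base \<open>q\<close> factor by Pascal's rule, the summands differ from those
  of the right-hand side by a term of the shape of \<open>alternating_sum_eq_0\<close> in base \<open>q\<^sup>2\<close>.
\<close>
lemma T0_Suc:
  "T0 (Suc m) A q = T0 m (A - 1) q + q powi (int m + 1 + A) * T1 m A q
     + q powi (2 * int m + 2 + 2 * A) * T0 m (A + 1) q"
proof -
  interpret p: generic_base "q\<^sup>2"
    by (rule generic_base_square)
  define B where "B s A = gauss q (2 * s) (s - A)" for s A :: int
  \<comment> \<open>\<open>C\<close> collects the odd central coefficients that occur halfway through the expansion of
    \<open>B (s + 1)\<close> into \<open>B s\<close>; their total contribution is the vanishing alternating sum.\<close>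
  define C where "C r = gauss q (2 * (int m - int r) + 1) (int m - int r + 1 - A)" for r
  define c where "c r = (-1) ^ r * gauss (q\<^sup>2) (int m) (int r)" for r
  have T0_B: "T0 m A q = (\<Sum>r=0..m. c r * B (int m - int r) A)" for A
    unfolding T0_def c_def B_def by (intro sum.cong refl) (simp add: algebra_simps)
  have T1_B: "T1 m A q = (\<Sum>r=0..m. c r * (q ^ r * B (int m - int r) A))"
    unfolding T1_def c_def B_def power_minus[of q]
    by (intro sum.cong refl) (simp add: algebra_simps)
  have "T0 (Suc m) A q = (\<Sum>r=0..Suc m. (-1) ^ r * gauss (q\<^sup>2) (int (Suc m)) (int r)
      * B (int m + 1 - int r) A)"
    unfolding T0_def B_def by (intro sum.cong refl) (simp add: algebra_simps)
  also have "\<dots> = (\<Sum>r=0..m. c r *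
      ((q\<^sup>2) ^ r * B (int m + 1 - int r) A - B (int m - int r) A))"
    unfolding p.alternating_Pascal c_def by simp
  also have "\<dots> = (\<Sum>r=0..m. c r * B (int m - int r) (A - 1)
      + q powi (int m + 1 + A) * (c r * (q ^ r * B (int m - int r) A))
      + q powi (2 * int m + 2 + 2 * A) * (c r * B (int m - int r) (A + 1))
      - c r * ((1 - (q\<^sup>2) ^ r) * C r + (1 - (q\<^sup>2) ^ (m - r)) * C (Suc r)))"
  proof (intro sum.cong refl)
    fix r
    assume "r \<in> {0..m}"
    define s where "s = int m - int r"
    have s: "s \<ge> 0" "int m = s + int r" "int m + 1 - int r = s + 1" "int m - int r = s"
      using \<open>r \<in> {0..m}\<close> by (auto simp: s_def)
    define x where "x = q powi (s + A)"
    have Bs1: "B (s + 1) A = C r + q * x * (B s A + q * x * B s (A + 1))"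
    proof -
      have "B (s + 1) A = C r + q powi (s + A + 1) * gauss q (2 * s + 1) (s - A)"
        using gauss_Pascal_top[of "2 * s + 2" "s + 1 - A"] s
        by (simp add: B_def C_def algebra_simps)
      moreover have "gauss q (2 * s + 1) (s - A) = B s A + q powi (s + A + 1) * B s (A + 1)"
        using gauss_Pascal_top[of "2 * s + 1" "s - A"] s
        by (simp add: B_def algebra_simps)
      moreover have "q powi (s + A + 1) = q * x"
        using nonzero by (simp add: x_def power_int_add)
      ultimately show ?thesis
        by simp
    qed
    have Cr: "C r = B s (A - 1) + x * B s A"
    proof -
      have "2 * s + 1 \<noteq> 0"
        using s by simp
      from gauss_Pascal_top[OF this, of "s + 1 - A"] show ?thesis
        by (simp add: B_def C_def x_def s algebra_simps)
    qed
    have CSr: "(1 - x) * B s A = (1 - (q\<^sup>2) ^ (m - r)) * C (Suc r)"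
    proof -
      have "2 * s = int (2 * (m - r))"
        using \<open>r \<in> {0..m}\<close> by (simp add: s_def of_nat_diff)
      then have "(q\<^sup>2) ^ (m - r) = q powi (2 * s)"
        by (simp only: power_int_of_nat power_mult)
      moreover have "C (Suc r) = gauss q (2 * s - 1) (s - A)"
        by (simp add: C_def s_def algebra_simps)
      ultimately show ?thesis
        using gauss_absorb_top[of "2 * s" "s - A"] by (simp add: B_def x_def algebra_simps)
    qed
    have mA: "int m + 1 + A = int r + (1 + (s + A))"
      using s by simp
    have e1: "q powi (int m + 1 + A) = q ^ r * q * x"
      unfolding mA x_def by (simp add: power_int_add nonzero)
    have "2 * int m + 2 + 2 * A = (int m + 1 + A) + (int m + 1 + A)"
      by simp
    then have e2: "q powi (2 * int m + 2 + 2 * A) = q ^ r * q * x * (q ^ r * q * x)"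
      using nonzero unfolding e1[symmetric] by (metis power_int_add)
    have e3: "(q\<^sup>2) ^ r = q ^ r * q ^ r"
      by (simp add: power2_eq_square power_mult_distrib)
    show "c r * ((q\<^sup>2) ^ r * B (int m + 1 - int r) A - B (int m - int r) A) =
      c r * B (int m - int r) (A - 1)
      + q powi (int m + 1 + A) * (c r * (q ^ r * B (int m - int r) A))
      + q powi (2 * int m + 2 + 2 * A) * (c r * B (int m - int r) (A + 1))
      - c r * ((1 - (q\<^sup>2) ^ r) * C r + (1 - (q\<^sup>2) ^ (m - r)) * C (Suc r))"
      unfolding e1 e2 s(3,4) CSr[symmetric] Bs1 Cr e3 by (simp add: algebra_simps)
  qed
  also have "\<dots> = T0 m (A - 1) q + q powi (int m + 1 + A) * T1 m A q
     + q powi (2 * int m + 2 + 2 * A) * T0 m (A + 1) q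
     - (\<Sum>r=0..m. c r * ((1 - (q\<^sup>2) ^ r) * C r + (1 - (q\<^sup>2) ^ (m - r)) * C (Suc r)))"
    unfolding T0_B T1_B sum_distrib_left sum.distrib sum_subtractf by simp
  also have "(\<Sum>r=0..m. c r * ((1 - (q\<^sup>2) ^ r) * C r + (1 - (q\<^sup>2) ^ (m - r)) * C (Suc r))) = 0"
    unfolding c_def by (rule p.alternating_sum_eq_0)
  finally show ?thesis
    by simp
qed

lemma T0_Suc':
  "T0 (Suc m) A q = T0 m (A + 1) q + q powi (int m + 1 - A) * T1 m A q
     + q powi (2 * int m + 2 - 2 * A) * T0 m (A - 1) q"
  using T0_Suc[of m "- A"] T0_sym[of "Suc m" A] T0_sym[of m "A + 1"] T0_sym[of m "A - 1"]
    T1_sym[of m A]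
  by simp

section \<open>Theta sums of q-trinomial coefficients\<close>

text \<open>The modulus 5 and the quadratic coefficient 10 are the same in every sum that occurs, so
  only \<open>a\<close>, \<open>b\<close>, \<open>c\<close> are parameters.\<close>
definition theta_sum :: "(int \<Rightarrow> 'a) \<Rightarrow> int \<Rightarrow> int \<Rightarrow> int \<Rightarrow> 'a" where
  "theta_sum f a b c = Sum_any (\<lambda>k. q powi (10 * k\<^sup>2 + a * k + b) * f (5 * k + c))"

end

abbreviation finite_support :: "(int \<Rightarrow> 'a::zero) \<Rightarrow> bool" where
  "finite_support f \<equiv> finite {A. f A \<noteq> 0}"

lemma finite_support_T0: "finite_support (\<lambda>A. T0 m A q)"
proof (rule finite_subset)
  show "{A. T0 m A q \<noteq> 0} \<subseteq> {- int m..int m}"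
    using T0_eq_0[of m _ q] by force
qed simp

lemma finite_support_T1: "finite_support (\<lambda>A. T1 m A q)"
proof (rule finite_subset)
  show "{A. T1 m A q \<noteq> 0} \<subseteq> {- int m..int m}"
    using T1_eq_0[of m _ q] by force
qed simp

lemma finite_support_shift:
  assumes "finite_support f"
  shows "finite_support (\<lambda>A. f (A + d))"
proof (rule finite_subset)
  show "{A. f (A + d) \<noteq> 0} \<subseteq> (\<lambda>A. A - d) ` {A. f A \<noteq> 0}"
    by (force simp: image_iff intro: exI[of _ "_ + d"])
qed (use assms in simp)

lemma finite_support_mult:
  fixes f g :: "int \<Rightarrow> 'a::mult_zero"
  assumes "finite_support f"
  shows "finite_support (\<lambda>A. g A * f A)"
  by (rule finite_subset[OF _ assms]) auto

lemma finite_support_add: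
  fixes f g :: "int \<Rightarrow> 'a::monoid_add"
  assumes "finite_support f" "finite_support g"
  shows "finite_support (\<lambda>A. f A + g A)"
proof (rule finite_subset)
  show "{A. f A + g A \<noteq> 0} \<subseteq> {A. f A \<noteq> 0} \<union> {A. g A \<noteq> 0}"
    by auto
qed (use assms in simp)

context generic_base
begin

lemma finite_support_theta:
  assumes "finite_support f"
  shows "finite_support (\<lambda>k. q powi (10 * k\<^sup>2 + a * k + b) * f (5 * k + c))"
proof (rule finite_support_mult, rule finite_subset)
  show "{k. f (5 * k + c) \<noteq> 0} \<subseteq> (\<lambda>A. (A - c) div 5) ` {A. f A \<noteq> 0}"
    by (force simp: image_iff intro: exI[of _ "5 * _ + c"])
qed (use assms in simp)

lemma theta_add:
  assumes "finite_support f" "finite_support g"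
  shows "theta_sum (\<lambda>A. f A + g A) a b c = theta_sum f a b c + theta_sum g a b c"
  unfolding theta_sum_def distrib_left
  by (rule Sum_any.distrib) (intro finite_support_theta assms)+

lemma theta_shift: "theta_sum (\<lambda>A. f (A + d)) a b c = theta_sum f a b (c + d)"
  by (simp add: theta_sum_def add.assoc)

text \<open>
  Together with the shift, the reflection and the translation rules, this lets the
  q-trinomial relations be read as linear relations between parameter triples.
\<close>
lemma theta_twist:
  "theta_sum (\<lambda>A. q powi (u + v * A) * f A) a b c = theta_sum f (a + 5 * v) (b + u + v * c) c"
proof -
  have "q powi (10 * k\<^sup>2 + a * k + b) * q powi (u + v * (5 * k + c)) =
      q powi (10 * k\<^sup>2 + (a + 5 * v) * k + (b + u + v * c))" for k
    using nonzero by (simp flip: power_int_add add: algebra_simps)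
  then show ?thesis
    by (simp add: theta_sum_def flip: mult.assoc)
qed

lemma theta_two_terms:
  assumes "finite_support f" "finite_support g"
  shows "theta_sum (\<lambda>A. f (A + d) + q powi (u + v * A) * g (A + e)) a b c =
    theta_sum f a b (c + d) + theta_sum g (a + 5 * v) (b + u + v * c) (c + e)"
proof -
  have "finite_support (\<lambda>A. f (A + d))" "finite_support (\<lambda>A. g (A + e))"
    by (intro assms[THEN finite_support_shift])+
  then have "theta_sum (\<lambda>A. f (A + d) + q powi (u + v * A) * g (A + e)) a b c =
      theta_sum (\<lambda>A. f (A + d)) a b c + theta_sum (\<lambda>A. q powi (u + v * A) * g (A + e)) a b c"
    by (intro theta_add finite_support_mult)
  then show ?thesis
    by (simp only: theta_shift theta_twist)
qed

lemma theta_three_terms: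
  assumes "finite_support f" "finite_support g" "finite_support h"
  shows "theta_sum (\<lambda>A. f (A + d) + q powi (u + v * A) * g (A + e)
        + q powi (u' + v' * A) * h (A + e')) a b c =
    theta_sum f a b (c + d) + theta_sum g (a + 5 * v) (b + u + v * c) (c + e)
      + theta_sum h (a + 5 * v') (b + u' + v' * c) (c + e')"
proof -
  have "finite_support (\<lambda>A. f (A + d))" "finite_support (\<lambda>A. g (A + e))"
    "finite_support (\<lambda>A. h (A + e'))"
    by (intro assms[THEN finite_support_shift])+
  then have "theta_sum (\<lambda>A. f (A + d) + q powi (u + v * A) * g (A + e)
        + q powi (u' + v' * A) * h (A + e')) a b c =
      theta_sum (\<lambda>A. f (A + d) + q powi (u + v * A) * g (A + e)) a b c
      + theta_sum (\<lambda>A. q powi (u' + v' * A) * h (A + e')) a b c"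
    by (intro theta_add finite_support_add finite_support_mult)
  then show ?thesis
    by (simp only: theta_two_terms[OF assms(1,2)] theta_shift theta_twist)
qed

lemma theta_scale:
  assumes "finite_support f"
  shows "q powi u * theta_sum f a b c = theta_sum f a (b + u) c"
proof -
  have "q powi u * q powi (10 * k\<^sup>2 + a * k + b) = q powi (10 * k\<^sup>2 + a * k + (b + u))" for k
    using nonzero by (simp flip: power_int_add add: algebra_simps)
  then show ?thesis
    unfolding theta_sum_def Sum_any_right_distrib[OF finite_support_theta[OF assms]]
    by (simp flip: mult.assoc)
qed

lemma theta_reflect:
  assumes even: "\<And>A. f (- A) = f A"
  shows "theta_sum f a b c = theta_sum f (- a) b (- c)"
  unfolding theta_sum_def
proof (rule Sum_any.reindex_cong[of uminus])
  show "bij (uminus :: int \<Rightarrow> int)"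
    by (rule bij_uminus)
  have "f (5 * - k + c) = f (5 * k + - c)" for k
    using even[of "5 * k + - c"] by simp
  then show "(\<lambda>k. q powi (10 * k\<^sup>2 + a * k + b) * f (5 * k + c)) \<circ> uminus =
      (\<lambda>k. q powi (10 * k\<^sup>2 + - a * k + b) * f (5 * k + - c))"
    by (simp add: fun_eq_iff)
qed

lemma theta_translate:
  "theta_sum f a b c = theta_sum f (a + 20) (10 + a + b) (c + 5)"
  unfolding theta_sum_def
proof (rule Sum_any.reindex_cong[of "\<lambda>k. k + 1"])
  show "bij (\<lambda>k::int. k + 1)"
    by (rule bij_plus_right)
  have "10 * (k + 1)\<^sup>2 + a * (k + 1) + b = 10 * k\<^sup>2 + (a + 20) * k + (10 + a + b)" for k
    by (simp add: power2_eq_square algebra_simps)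
  moreover have "5 * (k + 1) + c = 5 * k + (c + 5)" for k
    by simp
  ultimately show "(\<lambda>k. q powi (10 * k\<^sup>2 + a * k + b) * f (5 * k + c)) \<circ> (\<lambda>k. k + 1) =
      (\<lambda>k. q powi (10 * k\<^sup>2 + (a + 20) * k + (10 + a + b)) * f (5 * k + (c + 5)))"
    by (simp only: fun_eq_iff o_def) simp
qed

abbreviation theta0 :: "nat \<Rightarrow> int \<Rightarrow> int \<Rightarrow> int \<Rightarrow> 'a" where
  "theta0 m \<equiv> theta_sum (\<lambda>A. T0 m A q)"

abbreviation theta1 :: "nat \<Rightarrow> int \<Rightarrow> int \<Rightarrow> int \<Rightarrow> 'a" where
  "theta1 m \<equiv> theta_sum (\<lambda>A. T1 m A q)"

lemma theta1_diff:
  "theta1 m a b (c + 1) + theta0 m (a - 5) (b + int m - c) c =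
   theta1 m a b c + theta0 m (a + 5) (b + int m + 1 + c) (c + 1)"
proof -
  have "T1 m (A + 1) q + q powi (int m + (- 1) * A) * T0 m (A + 0) q =
      T1 m (A + 0) q + q powi (int m + 1 + 1 * A) * T0 m (A + 1) q" for A
    using T1_diff[of m A] by (simp add: algebra_simps)
  then have "theta_sum (\<lambda>A. T1 m (A + 1) q + q powi (int m + (- 1) * A) * T0 m (A + 0) q) a b c =
      theta_sum (\<lambda>A. T1 m (A + 0) q + q powi (int m + 1 + 1 * A) * T0 m (A + 1) q) a b c"
    by presburger
  then show ?thesis
    unfolding theta_two_terms[OF finite_support_T1 finite_support_T0] by (simp add: algebra_simps)
qed

lemma theta0_Suc:
  "theta0 (Suc m) a b c = theta0 m a b (c - 1) + theta1 m (a + 5) (b + int m + 1 + c) c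
     + theta0 m (a + 10) (b + 2 * int m + 2 + 2 * c) (c + 1)"
proof -
  have "T0 (Suc m) A q = T0 m (A + - 1) q + q powi (int m + 1 + 1 * A) * T1 m (A + 0) q
     + q powi (2 * int m + 2 + 2 * A) * T0 m (A + 1) q" for A
    using T0_Suc[of m A] by simp
  then have "theta0 (Suc m) a b c = theta_sum (\<lambda>A. T0 m (A + - 1) q
     + q powi (int m + 1 + 1 * A) * T1 m (A + 0) q
     + q powi (2 * int m + 2 + 2 * A) * T0 m (A + 1) q) a b c"
    by presburger
  then show ?thesis
    unfolding theta_three_terms[OF finite_support_T0 finite_support_T1 finite_support_T0]
    by (simp add: algebra_simps)
qed

lemma theta0_reflect: "theta0 m a b c = theta0 m (- a) b (- c)"
  by (rule theta_reflect) (rule T0_sym)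

lemma theta1_reflect: "theta1 m a b c = theta1 m (- a) b (- c)"
  by (rule theta_reflect) (rule T1_sym)

lemma theta0_Suc':
  "theta0 (Suc m) a b c = theta0 m a b (c + 1) + theta1 m (a - 5) (b + int m + 1 - c) c
     + theta0 m (a - 10) (b + 2 * int m + 2 - 2 * c) (c - 1)"
proof -
  have "theta0 (Suc m) a b c = theta0 (Suc m) (- a) b (- c)"
    by (rule theta0_reflect)
  also have "\<dots> = theta0 m (- a) b (- (c + 1))
      + theta1 m (- (a - 5)) (b + int m + 1 - c) (- c)
      + theta0 m (- (a - 10)) (b + 2 * int m + 2 - 2 * c) (- (c - 1))"
    using theta0_Suc[of m "- a" b "- c"] by simp
  finally show ?thesis
    by (simp only: theta0_reflect[symmetric] theta1_reflect[symmetric])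
qed

section \<open>The recurrence on the theta side\<close>

text \<open>
  The contributions of \<open>T0(m, A)\<close> and of \<open>T0(m, A + 1)\<close> to the sum of the terms with \<open>U(m, A)\<close>.
\<close>
definition theta_left :: "nat \<Rightarrow> 'a" where
  "theta_left m = theta0 m 3 0 0 - theta0 m 7 1 1"

definition theta_right :: "nat \<Rightarrow> 'a" where
  "theta_right m = theta0 m 3 0 1 - theta0 m 7 1 2"

text \<open>
  \<open>theta0_Suc'\<close> is used, rather than \<open>theta0_Suc\<close>, because its leading terms form exactly
  \<open>theta_right m\<close>.  The \<open>theta1\<close> terms are brought together by reflection and become \<open>theta0\<close>
  terms by \<open>theta1_diff\<close>; these cancel the trailing terms of \<open>theta0_Suc'\<close>.
\<close>
lemma theta_left_Suc: "theta_left (Suc m) = theta_right m"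
proof -
  define n where "n = int m"
  have "theta0 (Suc m) 3 0 0 =
      theta0 m 3 0 1 + theta1 m (- 2) (n + 1) 0 + theta0 m (- 7) (2 * n + 2) (- 1)"
    using theta0_Suc'[of m 3 0 0] by (simp add: n_def)
  moreover have "theta0 (Suc m) 7 1 1 =
      theta0 m 7 1 2 + theta1 m 2 (n + 1) 1 + theta0 m (- 3) (2 * n + 1) 0"
    using theta0_Suc'[of m 7 1 1] by (simp add: n_def add.commute)
  moreover have "theta1 m (- 2) (n + 1) 0 = theta1 m 2 (n + 1) 0"
    using theta1_reflect[of m 2 "n + 1" 0] by simp
  moreover have "theta0 m (- 7) (2 * n + 2) (- 1) = theta0 m 7 (2 * n + 2) 1"
    using theta0_reflect[of m 7 "2 * n + 2" 1] by simp
  moreover have "theta1 m 2 (n + 1) 1 + theta0 m (- 3) (2 * n + 1) 0 =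
      theta1 m 2 (n + 1) 0 + theta0 m 7 (2 * n + 2) 1"
    using theta1_diff[of m 2 "n + 1" 0] by (simp add: n_def algebra_simps)
  ultimately show ?thesis
    unfolding theta_left_def theta_right_def by algebra
qed

text \<open>
  Here \<open>theta0_Suc\<close> produces \<open>theta_left m\<close>.  A reflection followed by a translation leaves
  \<open>theta1\<close> terms with the same \<open>a\<close> and \<open>b\<close> at \<open>c = 1\<close> and \<open>c = 3\<close>, so \<open>theta1_diff\<close> is applied twice.
\<close>
lemma theta_right_Suc: "theta_right (Suc m) = theta_left m + q ^ (2 * m + 1) * theta_right m"
proof -
  define n where "n = int m"
  have "theta0 (Suc m) 3 0 1 =
      theta0 m 3 0 0 + theta1 m 8 (n + 2) 1 + theta0 m 13 (2 * n + 4) 2"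
    using theta0_Suc[of m 3 0 1] by (simp add: n_def algebra_simps)
  moreover have "theta0 (Suc m) 7 1 2 =
      theta0 m 7 1 1 + theta1 m 12 (n + 4) 2 + theta0 m 17 (2 * n + 7) 3"
    using theta0_Suc[of m 7 1 2] by (simp add: n_def algebra_simps)
  moreover have "theta1 m 12 (n + 4) 2 = theta1 m 8 (n + 2) 3"
    using theta1_reflect[of m 12 "n + 4" 2] theta_translate[of _ "- 12" "n + 4" "- 2"]
    by (simp add: algebra_simps)
  moreover have "theta0 m 17 (2 * n + 7) 3 = theta0 m 3 (2 * n) 2"
    using theta0_reflect[of m 17 "2 * n + 7" 3] theta_translate[of _ "- 17" "2 * n + 7" "- 3"]
    by (simp add: algebra_simps)
  moreover have "theta0 m 13 (2 * n + 5) 3 = theta0 m 7 (2 * n + 2) 2"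
    using theta0_reflect[of m 13 "2 * n + 5" 3] theta_translate[of _ "- 13" "2 * n + 5" "- 3"]
    by (simp add: algebra_simps)
  moreover have "theta1 m 8 (n + 2) 2 + theta0 m 3 (2 * n + 1) 1 =
      theta1 m 8 (n + 2) 1 + theta0 m 13 (2 * n + 4) 2"
    using theta1_diff[of m 8 "n + 2" 1] by (simp add: n_def algebra_simps)
  moreover have "theta1 m 8 (n + 2) 3 + theta0 m 3 (2 * n) 2 =
      theta1 m 8 (n + 2) 2 + theta0 m 13 (2 * n + 5) 3"
    using theta1_diff[of m 8 "n + 2" 2] by (simp add: n_def algebra_simps)
  ultimately have "theta_right (Suc m) =
      theta_left m + (theta0 m 3 (2 * n + 1) 1 - theta0 m 7 (2 * n + 2) 2)"
    unfolding theta_left_def theta_right_def by algebra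
  moreover have "q ^ (2 * m + 1) = q powi (2 * n + 1)"
    unfolding n_def by (subst power_int_of_nat[symmetric]) (simp add: add.commute)
  ultimately show ?thesis
    by (simp add: theta_right_def right_diff_distrib theta_scale finite_support_T0 add.commute)
qed

lemma T0_0: "T0 0 A q = (if A = 0 then 1 else 0)"
  by (auto simp: T0_def gauss_def qpoch_def)

lemma theta_left_0: "theta_left 0 = 1"
proof -
  have "theta0 0 3 0 0 = Sum_any (\<lambda>k::int. if k = 0 then 1 else 0)"
    unfolding theta_sum_def by (rule Sum_any.cong) (simp add: T0_0)
  moreover have "5 * k + 1 \<noteq> 0" for k :: int
    by presburger
  ultimately show ?thesis
    by (simp add: theta_left_def theta_sum_def T0_0)
qed

lemma theta_right_0: "theta_right 0 = 0"
proof -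
  have "5 * k + 1 \<noteq> 0" "5 * k + 2 \<noteq> 0" for k :: int
    by presburger+
  then show ?thesis
    by (simp add: theta_right_def theta_sum_def T0_0)
qed

lemma theta_U: "theta_sum (\<lambda>A. U n A q) a b c = theta0 n a b c + theta0 n a b (c + 1)"
proof -
  have "finite_support (\<lambda>A. T0 n (A + 1) q)"
    by (rule finite_support_shift[OF finite_support_T0])
  from theta_add[OF finite_support_T0[of n q] this] show ?thesis
    by (simp only: U_def theta_shift[of "\<lambda>A. T0 n A q" 1])
qed

lemma theta_difference_eq:
  "Sum_any (\<lambda>k::int. q powi (10 * k\<^sup>2 + 3 * k) * U n (5 * k) q
      - q powi (10 * k\<^sup>2 + 7 * k + 1) * U n (5 * k + 1) q) = theta_left n + theta_right n"
    (is "Sum_any ?h = _")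
proof -
  let ?f = "\<lambda>k::int. q powi (10 * k\<^sup>2 + 3 * k + 0) * U n (5 * k + 0) q"
  let ?g = "\<lambda>k::int. q powi (10 * k\<^sup>2 + 7 * k + 1) * U n (5 * k + 1) q"
  have U: "finite_support (\<lambda>A. U n A q)"
    unfolding U_def
    by (intro finite_support_add finite_support_T0 finite_support_shift[OF finite_support_T0])
  have "Sum_any (\<lambda>k. ?f k + (- 1) * ?g k) = Sum_any ?f + Sum_any (\<lambda>k. (- 1) * ?g k)"
    by (intro Sum_any.distrib finite_support_theta[OF U] finite_support_mult)
  also have "Sum_any (\<lambda>k. (- 1) * ?g k) = (- 1) * Sum_any ?g"
    by (rule Sum_any_right_distrib[symmetric]) (rule finite_support_theta[OF U])
  also have "Sum_any ?f = theta_sum (\<lambda>A. U n A q) 3 0 0"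
    by (simp add: theta_sum_def)
  also have "Sum_any ?g = theta_sum (\<lambda>A. U n A q) 7 1 1"
    by (simp add: theta_sum_def)
  finally show ?thesis
    by (simp add: theta_U theta_left_def theta_right_def)
qed

text \<open>By \<open>theta_difference_eq\<close> this is the bilateral sum of the theorem.\<close>
definition theta_side :: "nat \<Rightarrow> 'a" where
  "theta_side n = theta_left (n + 1) + theta_right (n + 1)"

lemma theta_side_eq: "theta_side n = theta_right n + theta_right (Suc n)"
  by (simp add: theta_side_def theta_left_Suc)

lemma theta_right_rec:
  "theta_right (Suc (Suc n)) = theta_right n + q ^ (2 * n + 3) * theta_right (Suc n)"
proof -
  have "2 * Suc n + 1 = 2 * n + 3"
    by simp
  then show ?thesis
    using theta_right_Suc[of "Suc n"] by (simp only: theta_left_Suc)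
qed

lemma theta_side_0: "theta_side 0 = 1"
  by (simp add: theta_side_eq theta_right_Suc theta_left_0 theta_right_0)

lemma theta_side_1: "theta_side 1 = q ^ 3 + 1"
  using theta_right_rec[of 0]
  by (simp add: theta_side_eq theta_right_Suc theta_left_0 theta_right_0)

lemma theta_side_rec:
  "theta_side (n + 2) =
    (1 - q\<^sup>2 + q ^ (2 * n + 5)) * theta_side (n + 1) + q\<^sup>2 * theta_side n"
proof -
  define w where "w i = theta_right (n + i)" for i
  have w: "w 2 = w 0 + q ^ (2 * n + 3) * w 1" "w 3 = w 1 + q ^ (2 * n + 5) * w 2"
    using theta_right_rec[of n] theta_right_rec[of "n + 1"] by (simp_all add: w_def eval_nat_numeral)
  have R: "theta_side n = w 0 + w 1" "theta_side (n + 1) = w 1 + w 2"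
    "theta_side (n + 2) = w 2 + w 3"
    by (simp_all add: w_def theta_side_eq eval_nat_numeral)
  have "2 * n + 5 = 2 + (2 * n + 3)"
    by simp
  then have "q ^ (2 * n + 5) = q\<^sup>2 * q ^ (2 * n + 3)"
    by (metis power_add)
  then show ?thesis
    unfolding R w by (simp only: algebra_simps mult_1_left)
qed

section \<open>The recurrence for the double sum\<close>

lemma gauss_n_0: "n \<ge> 0 \<Longrightarrow> gauss q n 0 = 1"
  using qpoch_nonzero by (simp add: gauss_def) (simp add: qpoch_def)

lemma gauss_n_n: "n \<ge> 0 \<Longrightarrow> gauss q n n = 1"
  using gauss_sym[of n 0] by (simp add: gauss_n_0)

text \<open>The expansion of \<open>x^j / (x;q)_(j+1)\<close>.\<close>
definition column_fps :: "nat \<Rightarrow> 'a fps" where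
  "column_fps j = Abs_fps (\<lambda>n. gauss q (int n) (int j))"

text \<open>The expansion of \<open>1 / (-q x;q)_j\<close>; the convention at \<open>j = k = 0\<close> makes it \<open>1\<close> for \<open>j = 0\<close>.\<close>
definition shifted_fps :: "nat \<Rightarrow> 'a fps" where
  "shifted_fps j = Abs_fps (\<lambda>k. (- q) ^ k * gauss_shifted q j k)"

text \<open>
  Removing the factor \<open>1 - x\<close> from the denominator leaves the series of index \<open>j\<close> at \<open>q x\<close>, up to
  \<open>x\<close> and a power of \<open>q\<close>.  An integer exponent is needed since \<open>n - j\<close> is negative where the Gaussian
  polynomial vanishes.
\<close>
lemma column_fps_Suc:
  "(1 - fps_X) * column_fps (Suc j) =
   fps_X * Abs_fps (\<lambda>n. q powi (int n - int j) * gauss q (int n) (int j))"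
proof (rule fps_ext)
  fix n
  show "((1 - fps_X) * column_fps (Suc j)) $ n =
    (fps_X * Abs_fps (\<lambda>n. q powi (int n - int j) * gauss q (int n) (int j))) $ n"
  proof (cases n)
    case 0
    then show ?thesis
      by (simp add: column_fps_def gauss_def)
  next
    case (Suc m)
    then show ?thesis
      using gauss_Pascal_top[of "int (Suc m)" "int (Suc j)"]
      by (simp add: column_fps_def left_diff_distrib)
  qed
qed

lemma shifted_fps_Suc:
  "(1 + fps_const q * fps_X) * shifted_fps (Suc j) =
   Abs_fps (\<lambda>k. q ^ k * (shifted_fps j $ k))"
proof (rule fps_ext)
  fix k
  show "((1 + fps_const q * fps_X) * shifted_fps (Suc j)) $ k =
    Abs_fps (\<lambda>k. q ^ k * (shifted_fps j $ k)) $ k"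
  proof (cases k)
    case 0
    then show ?thesis
      by (simp add: shifted_fps_def distrib_right mult.assoc gauss_shifted_def gauss_n_0)
  next
    case (Suc m)
    have "q powi (1 + int m) = q * q ^ m"
      by (simp add: power_int_add nonzero)
    with Suc show ?thesis
      using gauss_Pascal_bottom[of "int j + int (Suc m)" "int (Suc m)"]
      by (simp add: shifted_fps_def distrib_right mult.assoc gauss_shifted_def algebra_simps)
  qed
qed

definition inner_sum :: "nat \<Rightarrow> nat \<Rightarrow> 'a" where
  "inner_sum j n = (shifted_fps j * column_fps j) $ n"

text \<open>
  The coefficient form of multiplication by \<open>(1 - x) (1 + q x) = 1 - (1 - q) x - q x\<^sup>2\<close>.
\<close>
lemma inner_sum_Suc_rec:
  "inner_sum (Suc j) (n + 2) =
     (1 - q) * inner_sum (Suc j) (n + 1) + q * inner_sum (Suc j) n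
     + q powi (int n + 1 - int j) * inner_sum j (n + 1)"
proof -
  define F where "F = shifted_fps (Suc j) * column_fps (Suc j)"
  define B where "B = Abs_fps (\<lambda>k. q ^ k * (shifted_fps j $ k))"
  define A where "A = Abs_fps (\<lambda>n. q powi (int n - int j) * gauss q (int n) (int j))"
  have "b * a = (1 - c) * (x * (b * a)) + c * (x * (x * (b * a))) + x * (b' * a')"
    if "(1 - x) * a = x * a'" "(1 + c * x) * b = b'" for a b a' b' c x :: "'a fps"
    using that by algebra
  from this[OF column_fps_Suc shifted_fps_Suc]
  have F: "F = (1 - fps_const q) * (fps_X * F) + fps_const q * (fps_X * (fps_X * F))
      + fps_X * (B * A)"
    unfolding F_def B_def A_def .
  have "(B * A) $ (n + 1) = q powi (int n + 1 - int j) * inner_sum j (n + 1)"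
    unfolding inner_sum_def fps_mult_nth sum_distrib_left
  proof (intro sum.cong refl)
    fix i
    assume "i \<in> {0..n + 1}"
    then have "int n + 1 - int j = int i + (int (n + 1 - i) - int j)"
      by (simp add: of_nat_diff)
    then have "q powi (int n + 1 - int j) = q ^ i * q powi (int (n + 1 - i) - int j)"
      using nonzero by (metis power_int_add power_int_of_nat)
    then show "B $ i * A $ (n + 1 - i) = q powi (int n + 1 - int j) *
        (shifted_fps j $ i * column_fps j $ (n + 1 - i))"
      by (simp add: A_def B_def column_fps_def)
  qed
  moreover have "F $ (n + 2) = (1 - q) * F $ (n + 1) + q * F $ n + (B * A) $ (n + 1)"
    by (subst F) (simp add: left_diff_distrib)
  ultimately show ?thesis
    by (simp add: inner_sum_def F_def)
qed

lemma inner_sum_0: "inner_sum 0 n = 1"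
proof -
  have "shifted_fps 0 = 1"
    by (rule fps_ext) (simp add: shifted_fps_def gauss_shifted_def gauss_def)
  then show ?thesis
    by (simp add: inner_sum_def column_fps_def gauss_n_0)
qed

lemma inner_sum_eq_0: "n < j \<Longrightarrow> inner_sum j n = 0"
  unfolding inner_sum_def fps_mult_nth by (intro sum.neutral) (auto simp: column_fps_def gauss_def)

lemma inner_sum_1_1: "inner_sum 1 1 = 1"
  by (simp add: inner_sum_def fps_mult_nth column_fps_def shifted_fps_def gauss_shifted_def gauss_n_0
      gauss_n_n gauss_def[of _ 0 1])

end

context generic_base
begin

interpretation p: generic_base "q\<^sup>2"
  by (rule generic_base_square)

lemma P_eq_sum:
  assumes "n \<le> N"
  shows "P n q = (\<Sum>j\<le>N. q ^ (j\<^sup>2 + 2 * j) * p.inner_sum j n)"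
proof -
  have inner: "Sum_any (P_summand n q j) = q ^ (j\<^sup>2 + 2 * j) * p.inner_sum j n" for j
  proof -
    have "Sum_any (P_summand n q j) = (\<Sum>k=0..n. P_summand n q j k)"
    proof (rule Sum_any.expand_superset)
      show "{k. P_summand n q j k \<noteq> 0} \<subseteq> {0..n}"
        using P_summand_eq_0[of n j _ q] by (metis (mono_tags) atLeast0AtMost atMost_iff
            mem_Collect_eq not_le subsetI)
    qed simp
    also have "\<dots> = (\<Sum>k=0..n. q ^ (j\<^sup>2 + 2 * j) *
        (p.shifted_fps j $ k * p.column_fps j $ (n - k)))"
      by (intro sum.cong refl)
        (simp add: P_summand_def p.shifted_fps_def p.column_fps_def power_minus[of "q\<^sup>2"]
          power_add power_mult of_nat_diff)
    also have "\<dots> = q ^ (j\<^sup>2 + 2 * j) * p.inner_sum j n"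
      by (simp add: p.inner_sum_def fps_mult_nth sum_distrib_left)
    finally show ?thesis .
  qed
  have "P n q = Sum_any (\<lambda>j. q ^ (j\<^sup>2 + 2 * j) * p.inner_sum j n)"
    by (simp add: P_def inner)
  also have "\<dots> = (\<Sum>j\<le>N. q ^ (j\<^sup>2 + 2 * j) * p.inner_sum j n)"
  proof (rule Sum_any.expand_superset)
    show "{j. q ^ (j\<^sup>2 + 2 * j) * p.inner_sum j n \<noteq> 0} \<subseteq> {..N}"
    proof
      fix j
      assume "j \<in> {j. q ^ (j\<^sup>2 + 2 * j) * p.inner_sum j n \<noteq> 0}"
      then have "\<not> n < j"
        using p.inner_sum_eq_0[of n j] by auto
      then show "j \<in> {..N}"
        using assms by simp
    qed
  qed simp
  finally show ?thesis .
qed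

lemma P_0: "P 0 q = 1"
  by (simp add: P_eq_sum[of 0 0] p.inner_sum_0)

lemma P_1: "P 1 q = q ^ 3 + 1"
  unfolding P_eq_sum[OF order_refl] using p.inner_sum_1_1 by (simp add: p.inner_sum_0 numeral_3_eq_3)

text \<open>
  The \<open>j = 0\<close> summand is constant in \<open>n\<close> and is compatible with the homogeneous recurrence, as
  \<open>1 = (1 - q\<^sup>2) + q\<^sup>2\<close>.  In the others, the inhomogeneous term of index \<open>j + 1\<close> is
  \<open>q^(2n+5)\<close> times the summand of index \<open>j\<close>, by \<open>weight\<close> below.
\<close>
lemma P_rec: "P (n + 2) q = (1 - q\<^sup>2 + q ^ (2 * n + 5)) * P (n + 1) q + q\<^sup>2 * P n q"
proof -
  define w where "w j = q ^ (j\<^sup>2 + 2 * j)" for j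
  have weight: "w (Suc j) * (q\<^sup>2) powi (int n + 1 - int j) = q ^ (2 * n + 5) * w j"
    if "j \<le> n + 1" for j
  proof -
    have "int n + 1 - int j = int (n + 1 - j)"
      using that by simp
    then have "(q\<^sup>2) powi (int n + 1 - int j) = (q\<^sup>2) ^ (n + 1 - j)"
      by (simp only: power_int_of_nat)
    moreover have "(Suc j)\<^sup>2 + 2 * Suc j + 2 * (n + 1 - j) = 2 * n + 5 + (j\<^sup>2 + 2 * j)"
      using that by (simp add: power2_eq_square)
    ultimately show ?thesis
      unfolding w_def by (simp only: flip: power_mult power_add)
  qed
  have step: "w (Suc j) * p.inner_sum (Suc j) (n + 2) =
      (1 - q\<^sup>2) * (w (Suc j) * p.inner_sum (Suc j) (n + 1))
      + q\<^sup>2 * (w (Suc j) * p.inner_sum (Suc j) n)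
      + q ^ (2 * n + 5) * (w j * p.inner_sum j (n + 1))" if "j \<le> n + 1" for j
  proof -
    have "w (Suc j) * p.inner_sum (Suc j) (n + 2) =
      (1 - q\<^sup>2) * (w (Suc j) * p.inner_sum (Suc j) (n + 1))
      + q\<^sup>2 * (w (Suc j) * p.inner_sum (Suc j) n)
      + w (Suc j) * (q\<^sup>2) powi (int n + 1 - int j) * p.inner_sum j (n + 1)"
      unfolding p.inner_sum_Suc_rec by (simp only: distrib_left mult.left_commute mult.assoc)
    then show ?thesis
      by (simp only: weight[OF that] mult.assoc)
  qed
  have P_split: "P m q = w 0 + (\<Sum>j\<le>n + 1. w (Suc j) * p.inner_sum (Suc j) m)" if "m \<le> n + 2" for m
    using P_eq_sum[OF that] unfolding w_def[symmetric]
    by (simp add: sum.atMost_Suc_shift p.inner_sum_0 del: sum.atMost_Suc)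
  have "P (n + 2) q = w 0 + (\<Sum>j\<le>n + 1. w (Suc j) * p.inner_sum (Suc j) (n + 2))"
    by (rule P_split) simp
  also have "(\<Sum>j\<le>n + 1. w (Suc j) * p.inner_sum (Suc j) (n + 2)) =
      (1 - q\<^sup>2) * (\<Sum>j\<le>n + 1. w (Suc j) * p.inner_sum (Suc j) (n + 1))
      + q\<^sup>2 * (\<Sum>j\<le>n + 1. w (Suc j) * p.inner_sum (Suc j) n)
      + q ^ (2 * n + 5) * (\<Sum>j\<le>n + 1. w j * p.inner_sum j (n + 1))"
    unfolding sum_distrib_left sum.distrib[symmetric] by (intro sum.cong refl step) simp
  also have "(\<Sum>j\<le>n + 1. w j * p.inner_sum j (n + 1)) = P (n + 1) q"
    unfolding w_def by (rule P_eq_sum[symmetric]) simp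
  also have "(\<Sum>j\<le>n + 1. w (Suc j) * p.inner_sum (Suc j) (n + 1)) = P (n + 1) q - w 0"
    using P_split[of "n + 1"] by simp
  also have "(\<Sum>j\<le>n + 1. w (Suc j) * p.inner_sum (Suc j) n) = P n q - w 0"
    using P_split[of n] by simp
  finally show ?thesis
    by (simp only: algebra_simps) simp
qed

lemma P_eq_theta_side: "P n q = theta_side n"
proof (induction n rule: induct_nat_012)
  case 0
  show ?case
    by (simp add: P_0 theta_side_0)
next
  case 1
  show ?case
    using P_1 theta_side_1 by simp
next
  case (ge2 n)
  then show ?case
    using P_rec[of n] theta_side_rec[of n] by simp
qed

end

theorem mainTheorem5:
  shows "(\<forall>n::nat. P n qvar =
            Sum_any (\<lambda>k::int.
              qvar powi (10 * k\<^sup>2 + 3 * k) * U (n + 1) (5 * k) qvar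
              - qvar powi (10 * k\<^sup>2 + 7 * k + 1) * U (n + 1) (5 * k + 1) qvar))
       \<and> P 0 qvar = 1
       \<and> P 1 qvar = qvar ^ 3 + 1
       \<and> (\<forall>n\<ge>2. P n qvar =
            (1 - qvar\<^sup>2 + qvar ^ (2 * n + 1)) * P (n - 1) qvar + qvar\<^sup>2 * P (n - 2) qvar)"
proof -
  interpret generic_base qvar
    by (rule generic_base_qvar)
  have sum_eq: "P n qvar = Sum_any (\<lambda>k::int.
      qvar powi (10 * k\<^sup>2 + 3 * k) * U (n + 1) (5 * k) qvar
      - qvar powi (10 * k\<^sup>2 + 7 * k + 1) * U (n + 1) (5 * k + 1) qvar)" for n
    by (simp only: theta_difference_eq P_eq_theta_side theta_side_def)
  have rec: "P n qvar =
      (1 - qvar\<^sup>2 + qvar ^ (2 * n + 1)) * P (n - 1) qvar + qvar\<^sup>2 * P (n - 2) qvar"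
    if "n \<ge> 2" for n
  proof -
    define m where "m = n - 2"
    have n: "n = m + 2" "n - 1 = m + 1" "n - 2 = m" "2 * n + 1 = 2 * m + 5"
      using that by (simp_all add: m_def)
    show ?thesis
      unfolding n(2-4) unfolding n(1) by (rule P_rec)
  qed
  show ?thesis
    using sum_eq P_0 P_1 rec by blast
qed

end
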